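(* There exists an even weight function $\omega\in C^\infty(\mathbb{T})$ such that $\omega(0)=0$; for some $\epsilon>0$, $\omega$ is increasing on $(0,\epsilon)$ and decreasing on $(-\epsilon,0)$ (monotonicity in the non-strict sense); and $$\limsup_{t\to0}\frac{\log\omega(rt)}{\log\omega(t)}=\infty\quad\text{for each } r\in(0,1),$$ and such that for some increasing sequence of positive integers $K_n$ and some constant $C$ the Bernstein inequality $$\|T_n'\omega\|_{C(\mathbb{T})}\le C\,K_n\,\|T_n\omega\|_{C(\mathbb{T})}$$ holds for every $n\in\mathbb{N}$ and every trigonometric polynomial $T_n$ of degree at most $K_n$.
   Context: $\mathbb{T}=\mathbb{R}/2\pi\mathbb{Z}$; a weight function is a nonnegative integrable function on $\mathbb{T}$; $\|\cdot\|_{C(\mathbb{T})}$ is the supremum norm. As is implicit in the use of $\log\omega$, $\omega(t)>0$ for $t\ne0$ near $0$. *)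

theory Defs
  imports "HOL-Analysis.Analysis"
begin

text \<open>Functions on the circle \<open>\<real>/2\<pi>\<int>\<close> are represented as \<open>2\<pi>\<close>-periodic functions on the real line.\<close>

definition periodic_2pi :: "(real \<Rightarrow> 'a) \<Rightarrow> bool" where
  "periodic_2pi f \<longleftrightarrow> (\<forall>t. f (t + 2 * pi) = f t)"

definition weight_function :: "(real \<Rightarrow> real) \<Rightarrow> bool" where
  "weight_function w \<longleftrightarrow>
     periodic_2pi w \<and> (\<forall>t. w t \<ge> 0) \<and> w absolutely_integrable_on {- pi..pi}"

definition smooth :: "(real \<Rightarrow> real) \<Rightarrow> bool" where
  "smooth f \<longleftrightarrow> (\<forall>n. (deriv ^^ n) f differentiable_on UNIV)"

text \<open>Coefficients are complex; those with \<open>c (- k) = cnj (c k)\<close> give exactly the real-valued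
  trigonometric polynomials.\<close>

definition trig_polys :: "nat \<Rightarrow> (real \<Rightarrow> complex) set" where
  "trig_polys N = {T. \<exists>c :: int \<Rightarrow> complex. T = (\<lambda>t. \<Sum>k = - int N..int N. c k * cis (of_int k * t))}"

text \<open>Only applied to continuous \<open>2\<pi>\<close>-periodic functions, for which the set is bounded and the
  supremum over the line is the supremum over the circle.\<close>

definition sup_norm :: "(real \<Rightarrow> 'a::real_normed_vector) \<Rightarrow> real" where
  "sup_norm f = (SUP t. norm (f t))"

end

theory Submission
  imports Defs "HOL-Complex_Analysis.Complex_Analysis" "HOL-Real_Asymp.Real_Asymp"
begin

text \<open>The weight is an infinite product of even trigonometric polynomials \<open>0 < Q\<^sub>n \<le> 1\<close>, each
  increasing in \<open>\<bar>t\<bar>\<close> on \<open>[-\<pi>, \<pi>]\<close> and jumping sharply at a radius \<open>b\<^sub>n\<close>: it is extremely small at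
  the origin, equals \<open>1/2\<close> at \<open>b\<^sub>n\<close>, and is extremely close to \<open>1\<close> for \<open>\<bar>t\<bar> \<ge> 2 b\<^sub>n\<close>. Let \<open>W\<^sub>n\<close> be the
  product of the first \<open>n\<close> factors and \<open>K\<^sub>n\<close> a common bound for its degree and for \<open>\<bar>W\<^sub>n' / W\<^sub>n\<bar>\<close>. The
  radii are chosen as small multiples of \<open>1 / K\<^sub>n\<close>.

  For \<open>T\<close> of degree at most \<open>K\<^sub>n\<close>, Bernstein's inequality applies to the trigonometric polynomial
  \<open>T W\<^sub>n\<close>, and the bound on \<open>W\<^sub>n' / W\<^sub>n\<close> turns it into a Bernstein inequality with weight \<open>W\<^sub>n\<close>. The
  remaining factors make a difference only for \<open>\<bar>t\<bar> < 2 b\<^sub>n\<close>, an interval so short that \<open>T W\<^sub>n\<close>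
  hardly changes on it; hence \<open>W\<^sub>n\<close> may be replaced by the whole product
  (\<open>weighted_bernstein\<close>).

  Going from \<open>b\<^sub>n\<close> to \<open>r b\<^sub>n\<close>, the factor \<open>Q\<^sub>n\<close> drops from \<open>1/2\<close> to a value that is tiny even
  compared with high powers of \<open>W\<^sub>n(0)\<close>, whence the limit superior is infinite
  (\<open>Limsup_ln_weight_ratio\<close>).

  Smoothness (\<open>smooth_weight\<close>) requires that \<open>W\<^sub>n\<^sub>+\<^sub>1 - W\<^sub>n\<close> be small compared with every power of the
  reciprocal of its degree; by Bernstein's inequality the series of these increments
  can then be differentiated term by term. Its size is of the order
  \<open>W\<^sub>n(0) + Q\<^sub>n(0)\<close> at most, so the steps must attain doubly
  exponential accuracy with exponential degree. Iterating the cubic \<open>s(y) = 3 y\<^sup>2 - 2 y\<^sup>3\<close> does this: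
  after \<open>i\<close> iterations the degree is \<open>3\<^sup>i\<close>, starting values on either side of \<open>1/2\<close> have come
  within about \<open>q ^ (2 ^ i)\<close> of \<open>0\<close> or \<open>1\<close>, with some \<open>q < 1\<close> depending on the starting value, and the logarithmic derivative has grown by a factor of at
  most \<open>2\<^sup>i\<close>. So \<open>Q\<^sub>n\<close> is the \<open>i\<^sub>n\<close>-th iterate of \<open>s\<close> at \<open>1/2 + (cos b\<^sub>n - cos t)/4\<close>, with
  \<open>i\<^sub>n\<close> growing geometrically and \<open>b\<^sub>n\<close> proportional to \<open>3 ^ (- i\<^sub>n\<^sub>-\<^sub>1)\<close>.\<close>

section \<open>Bernstein's inequality for trigonometric polynomials\<close>

text \<open>Inside the disc this is the maximum principle for \<open>p\<close>. Outside, the maximum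
  principle is applied to the reflected polynomial \<open>z\<^sup>m p(1/z)\<close>, \<open>m\<close> the degree of \<open>p\<close>, whose
  modulus at a point of the unit circle is that of \<open>p\<close> at the conjugate point.\<close>

lemma poly_growth_outside_circle:
  fixes p :: "complex poly"
  assumes deg: "degree p \<le> d" and bound: "\<And>z. norm z = 1 \<Longrightarrow> norm (poly p z) \<le> M"
    and z: "norm z \<le> R" and R: "1 \<le> R"
  shows "norm (poly p z) \<le> M * R ^ d"
proof -
  have disc: "norm (poly q x) \<le> M"
    if "\<And>z. norm z = 1 \<Longrightarrow> norm (poly q z) \<le> M" "norm x \<le> 1" for q :: "complex poly" and x
  proof (rule maximum_modulus_frontier[of "poly q" "cball 0 1"])
    show "poly q holomorphic_on interior (cball 0 1)" "continuous_on (closure (cball 0 1)) (poly q)"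
      by (auto intro!: holomorphic_intros continuous_intros)
  qed (use that in auto)
  have M: "0 \<le> M"
    using order_trans[OF norm_ge_zero bound[of 1]] by simp
  show ?thesis
  proof (cases "norm z \<le> 1")
    case True
    then have "norm (poly p z) \<le> M" using disc bound by blast
    also have "\<dots> \<le> M * R ^ d" using mult_left_mono[OF one_le_power[OF R] M] by simp
    finally show ?thesis .
  next
    case False
    then have z0: "z \<noteq> 0" by auto
    have "norm (poly (reflect_poly p) x) \<le> M" if "norm x = 1" for x
    proof -
      have "x \<noteq> 0" using that by auto
      then show ?thesis
        using bound[of "inverse x"] that
        by (simp add: poly_reflect_poly_nz norm_mult norm_power norm_inverse)
    qed
    moreover have "norm (inverse z) \<le> 1"
      using False by (simp add: norm_inverse inverse_le_1_iff)
    ultimately have "norm (poly (reflect_poly p) (inverse z)) \<le> M"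
      using disc by blast
    then have "norm (poly p z) / norm z ^ degree p \<le> M"
      using z0 by (simp add: poly_reflect_poly_nz norm_mult norm_power norm_inverse
          power_inverse divide_inverse mult.commute)
    then have "norm (poly p z) \<le> M * norm z ^ degree p"
      using z0 by (simp add: pos_divide_le_eq)
    also have "norm z ^ degree p \<le> R ^ degree p"
      using z by (intro power_mono) auto
    also have "R ^ degree p \<le> R ^ d"
      using R deg by (intro power_increasing) auto
    finally show ?thesis using M by (simp add: mult_left_mono)
  qed
qed

text \<open>Cauchy's estimate on a circle of radius \<open>1/d\<close>, which the polynomial bound leaves
  only a factor \<open>(1 + 1/d)\<^sup>d \<le> e < 3\<close> larger than on the unit circle.\<close>

lemma poly_derivative_on_circle:
  fixes p :: "complex poly"
  assumes deg: "degree p \<le> d" and bound: "\<And>z. norm z = 1 \<Longrightarrow> norm (poly p z) \<le> M"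
    and z: "norm z = 1"
  shows "norm (poly (pderiv p) z) \<le> 3 * real d * M"
proof (cases "d = 0")
  case True
  then have "pderiv p = 0" using deg by (simp add: pderiv_eq_0_iff)
  then show ?thesis using True by simp
next
  case False
  have M: "0 \<le> M"
    using bound[OF z] norm_ge_zero order_trans by blast
  have e: "(1 + 1 / real d) ^ d \<le> 3"
  proof -
    have "(1 + 1 / real d) ^ d \<le> exp (1 / real d) ^ d"
      by (intro power_mono) (auto simp: exp_ge_add_one_self)
    also have "\<dots> = exp 1" using False by (simp flip: exp_of_nat_mult)
    finally show ?thesis using exp_le by linarith
  qed
  have "norm ((deriv ^^ 1) (poly p) z) \<le> fact 1 * (M * 3) / (1 / real d) ^ 1"
  proof (rule Cauchy_inequality)
    fix x assume x: "norm (z - x) = 1 / real d"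
    have "norm x \<le> 1 + 1 / real d"
      using norm_triangle_ineq4[of z "z - x"] x z by simp
    then have "norm (poly p x) \<le> M * (1 + 1 / real d) ^ d"
      by (intro poly_growth_outside_circle[OF deg bound]) auto
    also have "\<dots> \<le> M * 3" using e M by (intro mult_left_mono) auto
    finally show "norm (poly p x) \<le> M * 3" .
  qed (use False in \<open>auto intro!: holomorphic_intros continuous_intros\<close>)
  moreover have "deriv (poly p) z = poly (pderiv p) z"
    by (intro DERIV_imp_deriv poly_DERIV)
  ultimately show ?thesis by (simp add: field_simps)
qed

text \<open>Writing \<open>T(t) = e\<^sup>-\<^sup>i\<^sup>N\<^sup>t p(e\<^sup>i\<^sup>t)\<close> with an ordinary polynomial \<open>p\<close> makes closure under
  products a fact about degrees of polynomials and opens the way to complex analysis.\<close>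

definition trig_poly :: "nat \<Rightarrow> (real \<Rightarrow> complex) \<Rightarrow> bool" where
  "trig_poly N T \<longleftrightarrow>
     (\<exists>p. degree p \<le> 2 * N \<and> (\<forall>t. T t = cis (- real N * t) * poly p (cis t)))"

lemma trig_poly_of_trig_polys:
  assumes "T \<in> trig_polys N"
  shows "trig_poly N T"
proof -
  obtain c where c: "T = (\<lambda>t. \<Sum>k = - int N..int N. c k * cis (of_int k * t))"
    using assms unfolding trig_polys_def by blast
  define p where "p = (\<Sum>j\<le>2 * N. monom (c (int j - int N)) j)"
  have "T t = cis (- real N * t) * poly p (cis t)" for t
  proof -
    have "T t = (\<Sum>j\<le>2 * N. c (int j - int N) * cis (of_int (int j - int N) * t))"
      unfolding c
      by (rule sum.reindex_bij_witness[of _ "\<lambda>j. int j - int N" "\<lambda>k. nat (k + int N)"]) auto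
    also have "\<dots> = (\<Sum>j\<le>2 * N. cis (- real N * t) * (c (int j - int N) * cis t ^ j))"
    proof (rule sum.cong[OF refl])
      fix j
      have "cis (of_int (int j - int N) * t) = cis (- real N * t) * cis t ^ j"
        by (simp add: Complex.DeMoivre cis_mult algebra_simps)
      then show "c (int j - int N) * cis (of_int (int j - int N) * t)
          = cis (- real N * t) * (c (int j - int N) * cis t ^ j)"
        by (simp add: mult_ac)
    qed
    finally show ?thesis
      by (simp add: p_def poly_sum poly_monom sum_distrib_left)
  qed
  moreover have "degree p \<le> 2 * N"
    unfolding p_def by (intro degree_sum_le) (auto intro: order_trans[OF degree_monom_le])
  ultimately show ?thesis unfolding trig_poly_def by blast
qed

lemma trig_poly_mult:
  assumes "trig_poly N S" "trig_poly K T"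
  shows "trig_poly (N + K) (\<lambda>t. S t * T t)"
proof -
  obtain p q where "degree p \<le> 2 * N" "\<And>t. S t = cis (- real N * t) * poly p (cis t)"
    "degree q \<le> 2 * K" "\<And>t. T t = cis (- real K * t) * poly q (cis t)"
    using assms unfolding trig_poly_def by blast
  moreover have "cis (- real (N + K) * t) = cis (- real N * t) * cis (- real K * t)" for t
    by (simp add: cis_mult algebra_simps)
  ultimately show ?thesis
    unfolding trig_poly_def
    by (intro exI[of _ "p * q"]) (auto intro!: order_trans[OF degree_mult_le])
qed

lemma trig_poly_add:
  assumes "trig_poly N S" "trig_poly N T"
  shows "trig_poly N (\<lambda>t. S t + T t)"
proof -
  obtain p q where "degree p \<le> 2 * N" "\<And>t. S t = cis (- real N * t) * poly p (cis t)"
    "degree q \<le> 2 * N" "\<And>t. T t = cis (- real N * t) * poly q (cis t)"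
    using assms unfolding trig_poly_def by blast
  then show ?thesis
    unfolding trig_poly_def
    by (intro exI[of _ "p + q"]) (auto intro!: degree_add_le simp: distrib_left)
qed

lemma trig_poly_const: "trig_poly N (\<lambda>t. c)"
  unfolding trig_poly_def
proof (intro exI conjI allI)
  show "degree (monom c N) \<le> 2 * N"
    using degree_monom_le[of c N] by simp
  show "c = cis (- real N * t) * poly (monom c N) (cis t)" for t
    by (simp add: poly_monom Complex.DeMoivre cis_mult)
qed

lemma trig_poly_cos: "trig_poly 1 (\<lambda>t. of_real (cos t))"
  unfolding trig_poly_def
proof (intro exI conjI allI)
  show "degree [:1 / 2, 0, 1 / 2 :: complex:] \<le> 2 * 1" by simp
  show "of_real (cos t) = cis (- real 1 * t) * poly [:1 / 2, 0, 1 / 2:] (cis t)" for t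
  proof -
    have "cis (- t) * (cis t * cis t) = cis t" by (simp add: cis_mult)
    then have "cis (- real 1 * t) * poly [:1 / 2, 0, 1 / 2:] (cis t) = (cis (- t) + cis t) / 2"
      by (simp add: algebra_simps add_divide_distrib)
    then show ?thesis by (simp add: complex_eq_iff)
  qed
qed

lemma trig_poly_mono:
  assumes "trig_poly N T" "N \<le> K"
  shows "trig_poly K T"
  using trig_poly_mult[OF assms(1) trig_poly_const[of "K - N" 1]] assms(2) by simp

text \<open>The sharp constant is \<open>1\<close>. Here \<open>7 N = N + 3 \<cdot> 2 N\<close>: differentiating \<open>e\<^sup>-\<^sup>i\<^sup>N\<^sup>t\<close> costs \<open>N\<close>, and
  differentiating \<open>p\<close>, of degree at most \<open>2 N\<close>, costs three times that degree.\<close>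

lemma trig_poly_bernstein:
  assumes "trig_poly N T"
  obtains T' where "\<And>t. (T has_vector_derivative T' t) (at t)" "trig_poly N T'"
    "\<And>M t. (\<And>s. norm (T s) \<le> M) \<Longrightarrow> norm (T' t) \<le> 7 * real N * M"
proof -
  obtain p where deg: "degree p \<le> 2 * N" and T: "\<And>t. T t = cis (- real N * t) * poly p (cis t)"
    using assms unfolding trig_poly_def by blast
  define q where "q = smult (- \<i> * of_nat N) p + smult \<i> (pCons 0 (pderiv p))"
  define T' where "T' = (\<lambda>t. cis (- real N * t) * poly q (cis t))"
  show thesis
  proof
    show "(T has_vector_derivative T' t) (at t)" for t
    proof -
      have cis_deriv: "((\<lambda>t. cis (a * t)) has_vector_derivative of_real a * (\<i> * cis (a * t))) (at t)"
        for a
        by (auto intro!: derivative_eq_intros simp: has_vector_derivative_complex_iff)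
      note c1 = cis_deriv[of "- real N"]
      have c2: "(cis has_vector_derivative \<i> * cis t) (at t)"
        using cis_deriv[of 1] by simp
      have "((poly p \<circ> cis) has_vector_derivative (\<i> * cis t) * poly (pderiv p) (cis t)) (at t)"
        by (rule field_vector_diff_chain_at[OF c2 poly_DERIV])
      from has_vector_derivative_mult[OF c1 this]
      show ?thesis unfolding T T'_def q_def o_def
        by (simp add: T[abs_def] algebra_simps scaleR_conv_of_real)
    qed
    have "degree (pCons 0 (pderiv p)) \<le> 2 * N"
    proof (cases "pderiv p = 0")
      case False
      then have "degree p \<noteq> 0" by (simp add: pderiv_eq_0_iff)
      then show ?thesis using deg by (simp add: degree_pCons_eq False degree_pderiv)
    qed simp
    then have "degree q \<le> 2 * N"
      unfolding q_def using deg
      by (intro degree_add_le) (auto intro: order_trans[OF degree_smult_le])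
    then show "trig_poly N T'" unfolding trig_poly_def T'_def by blast
    show "norm (T' t) \<le> 7 * real N * M" if M: "\<And>s. norm (T s) \<le> M" for M t
    proof -
      have p: "norm (poly p z) \<le> M" if "norm z = 1" for z
      proof -
        have "z \<noteq> 0" using that by auto
        then have "cis (Arg z) = z" using that cis_Arg[of z] by (simp add: sgn_eq)
        then have "norm (T (Arg z)) = norm (poly p z)"
          by (simp add: T norm_mult)
        then show ?thesis using M[of "Arg z"] by simp
      qed
      have "norm (T' t) = norm (- \<i> * of_nat N * poly p (cis t) + \<i> * (cis t * poly (pderiv p) (cis t)))"
        by (simp add: T'_def q_def norm_mult mult_ac)
      also have "\<dots> \<le> real N * norm (poly p (cis t)) + norm (poly (pderiv p) (cis t))"
        by (rule order_trans[OF norm_triangle_ineq]) (simp add: norm_mult)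
      also have "\<dots> \<le> real N * M + 3 * real (2 * N) * M"
        using p poly_derivative_on_circle[OF deg p]
        by (intro add_mono mult_left_mono) auto
      finally show ?thesis by (simp add: algebra_simps)
    qed
  qed
qed

lemma trig_poly_bounded:
  assumes "trig_poly N T"
  obtains M where "\<And>t. norm (T t) \<le> M"
proof -
  obtain p where T: "\<And>t. T t = cis (- real N * t) * poly p (cis t)"
    using assms unfolding trig_poly_def by blast
  have "compact (poly p ` sphere 0 1)"
    by (intro compact_continuous_image continuous_intros) auto
  then have "bounded (poly p ` sphere 0 1)" by (rule compact_imp_bounded)
  then obtain M where "\<And>z. z \<in> sphere 0 1 \<Longrightarrow> norm (poly p z) \<le> M"
    unfolding bounded_iff by blast
  then show thesis by (intro that[of M]) (simp add: T norm_mult)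
qed

section \<open>Smoothness of series of trigonometric polynomials\<close>

definition real_trig :: "nat \<Rightarrow> (real \<Rightarrow> real) \<Rightarrow> bool" where
  "real_trig N f \<longleftrightarrow> trig_poly N (\<lambda>t. of_real (f t))"

lemma real_trig_bernstein:
  assumes "real_trig N f"
  obtains f' where "\<And>t. (f has_real_derivative f' t) (at t)" "real_trig N f'"
    "\<And>M t. (\<And>s. \<bar>f s\<bar> \<le> M) \<Longrightarrow> \<bar>f' t\<bar> \<le> 7 * real N * M"
proof -
  obtain T' where T': "\<And>t. ((\<lambda>t. complex_of_real (f t)) has_vector_derivative T' t) (at t)"
    "trig_poly N T'"
    "\<And>M t. (\<And>s. norm (complex_of_real (f s)) \<le> M) \<Longrightarrow> norm (T' t) \<le> 7 * real N * M"
    using trig_poly_bernstein assms unfolding real_trig_def by blast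
  have Re: "(f has_real_derivative Re (T' t)) (at t)"
    and Im: "((\<lambda>t. 0) has_real_derivative Im (T' t)) (at t)" for t
    using T'(1)[of t] by (simp_all add: has_vector_derivative_complex_iff)
  have "Im (T' t) = 0" for t
    using DERIV_unique[OF Im DERIV_const] .
  then have real: "T' t = of_real (Re (T' t))" for t
    by (simp add: complex_eq_iff)
  show thesis
  proof (rule that[of "\<lambda>t. Re (T' t)"])
    show "real_trig N (\<lambda>t. Re (T' t))"
      using T'(2) real unfolding real_trig_def by (metis (no_types, lifting) ext)
    show "\<bar>Re (T' t)\<bar> \<le> 7 * real N * M" if "\<And>s. \<bar>f s\<bar> \<le> M" for M t
      using T'(3)[of M t] that order_trans[OF abs_Re_le_cmod] by auto
  qed (fact Re)
qed

text \<open>By Bernstein's inequality each differentiation costs at most a factor \<open>7 D n\<close> in the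
  bound \<open>\<rho> n\<close>, so the hypothesis on \<open>\<rho>\<close> and \<open>D\<close> is inherited by the derived series, and the
  series may be differentiated term by term any number of times.\<close>

lemma smooth_series:
  assumes "\<And>n. real_trig (D n) (f n)" and "\<And>n t. \<bar>f n t\<bar> \<le> \<rho> n"
    and "\<And>k. summable (\<lambda>n. \<rho> n * real (D n) ^ k)"
  shows "smooth (\<lambda>t. c + (\<Sum>n. f n t))"
  unfolding smooth_def
proof
  fix k
  have series: "\<exists>f'. (\<forall>n. real_trig (D n) (f' n)) \<and> (\<forall>n t. \<bar>f' n t\<bar> \<le> 7 * real (D n) * \<rho> n) \<and>
      (\<forall>t. ((\<lambda>t. c + (\<Sum>n. f n t)) has_real_derivative (\<Sum>n. f' n t)) (at t))"
    if f: "\<And>n. real_trig (D n) (f n)" and \<rho>: "\<And>n t. \<bar>f n t\<bar> \<le> \<rho> n"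
      and sum: "\<And>k. summable (\<lambda>n. \<rho> n * real (D n) ^ k)" for f \<rho> c
  proof -
    have "\<exists>f'. (\<forall>t. (f n has_real_derivative f' t) (at t)) \<and> real_trig (D n) f' \<and>
        (\<forall>t. \<bar>f' t\<bar> \<le> 7 * real (D n) * \<rho> n)" for n
      using real_trig_bernstein[OF f[of n]] \<rho> by metis
    then obtain f' where f': "\<And>n t. (f n has_real_derivative f' n t) (at t)"
      "\<And>n. real_trig (D n) (f' n)" "\<And>n t. \<bar>f' n t\<bar> \<le> 7 * real (D n) * \<rho> n"
      by metis
    have "uniformly_convergent_on UNIV (\<lambda>n t. \<Sum>i<n. f' i t)"
    proof (rule Weierstrass_m_test')
      show "norm (f' n t) \<le> 7 * (\<rho> n * real (D n) ^ 1)" for n t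
        using f'(3)[of n t] by (simp add: mult_ac)
    qed (intro summable_mult sum)
    moreover have "summable (\<lambda>n. f n 0)"
    proof (rule summable_comparison_test'[of \<rho> 0])
      show "summable \<rho>" using sum[of 0] by simp
      show "norm (f n 0) \<le> \<rho> n" for n using \<rho>[of n 0] by simp
    qed
    ultimately have "((\<lambda>t. \<Sum>n. f n t) has_real_derivative (\<Sum>n. f' n t)) (at t)" for t
      by (intro has_field_derivative_series'(2)[of UNIV]) (auto intro: f'(1))
    from DERIV_add[OF DERIV_const this] f' show ?thesis
      by (intro exI[of _ f']) auto
  qed
  show "(deriv ^^ k) (\<lambda>t. c + (\<Sum>n. f n t)) differentiable_on UNIV"
    using assms
  proof (induction k arbitrary: f \<rho> c)
    case (0 f \<rho> c)
    from series[OF this, of c] show ?case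
      unfolding differentiable_on_def real_differentiable_def funpow_0 by auto
  next
    case (Suc k f \<rho> c)
    from series[OF Suc.prems, of c] obtain f'
      where f': "\<And>n. real_trig (D n) (f' n)" "\<And>n t. \<bar>f' n t\<bar> \<le> 7 * real (D n) * \<rho> n"
        "\<And>t. ((\<lambda>t. c + (\<Sum>n. f n t)) has_real_derivative (\<Sum>n. f' n t)) (at t)"
      by blast
    have "summable (\<lambda>n. 7 * real (D n) * \<rho> n * real (D n) ^ j)" for j
      using summable_mult[OF Suc.prems(3)[of "Suc j"], of 7] by (simp add: mult_ac)
    from Suc.IH[OF f'(1,2) this, of 0]
    have "(deriv ^^ k) (\<lambda>t. \<Sum>n. f' n t) differentiable_on UNIV" by simp
    moreover have "deriv (\<lambda>t. c + (\<Sum>n. f n t)) = (\<lambda>t. \<Sum>n. f' n t)"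
      using f'(3) by (intro ext DERIV_imp_deriv)
    ultimately show ?case by (simp add: funpow_swap1)
  qed
qed

section \<open>Slowly varying trigonometric polynomials\<close>

text \<open>Degree and logarithmic derivative are bounded by the same number, since both enter the
  weighted Bernstein inequality in the same way. The second condition forces \<open>f \<ge> 0\<close> when
  \<open>N > 0\<close>.\<close>

definition slowly_varying :: "nat \<Rightarrow> (real \<Rightarrow> real) \<Rightarrow> bool" where
  "slowly_varying N f \<longleftrightarrow> real_trig N f \<and>
     (\<forall>t D. (f has_real_derivative D) (at t) \<longrightarrow> \<bar>D\<bar> \<le> real N * f t)"

lemma slowly_varyingE:
  assumes "slowly_varying N f"
  obtains f' where "\<And>t. (f has_real_derivative f' t) (at t)" "\<And>t. \<bar>f' t\<bar> \<le> real N * f t"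
  using assms real_trig_bernstein[of N f] unfolding slowly_varying_def by metis

lemma slowly_varyingI:
  assumes "real_trig N f" "\<And>t. (f has_real_derivative f' t) (at t)" "\<And>t. \<bar>f' t\<bar> \<le> real N * f t"
  shows "slowly_varying N f"
  using assms DERIV_unique unfolding slowly_varying_def by blast

lemma real_trig_mult: "real_trig N f \<Longrightarrow> real_trig K g \<Longrightarrow> real_trig (N + K) (\<lambda>t. f t * g t)"
  using trig_poly_mult[of N _ K] by (simp add: real_trig_def)

lemma real_trig_add: "real_trig N f \<Longrightarrow> real_trig N g \<Longrightarrow> real_trig N (\<lambda>t. f t + g t)"
  using trig_poly_add[of N] by (simp add: real_trig_def)

lemma real_trig_const: "real_trig N (\<lambda>t. c)"
  using trig_poly_const by (simp add: real_trig_def)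

lemma real_trig_mono: "real_trig N f \<Longrightarrow> N \<le> K \<Longrightarrow> real_trig K f"
  using trig_poly_mono by (simp add: real_trig_def)

lemma real_trig_cmult: "real_trig N f \<Longrightarrow> real_trig N (\<lambda>t. c * f t)"
  using real_trig_mult[OF real_trig_const[of 0 c]] by simp

lemma slowly_varying_mono:
  assumes "slowly_varying N f" "N \<le> K" "\<And>t. 0 \<le> f t"
  shows "slowly_varying K f"
proof -
  have "real N * f t \<le> real K * f t" for t
    using assms(2,3) by (intro mult_right_mono) auto
  then show ?thesis
    using assms(1,2) unfolding slowly_varying_def by (blast intro: order_trans real_trig_mono)
qed

lemma slowly_varying_one: "slowly_varying N (\<lambda>t. 1)"
  by (rule slowly_varyingI[OF real_trig_const, of _ "\<lambda>t. 0"]) auto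

lemma slowly_varying_mult:
  assumes "slowly_varying N f" "slowly_varying K g" "\<And>t. 0 \<le> f t" "\<And>t. 0 \<le> g t"
  shows "slowly_varying (N + K) (\<lambda>t. f t * g t)"
proof -
  obtain f' where f': "\<And>t. (f has_real_derivative f' t) (at t)" "\<And>t. \<bar>f' t\<bar> \<le> real N * f t"
    using assms(1) by (rule slowly_varyingE) blast
  obtain g' where g': "\<And>t. (g has_real_derivative g' t) (at t)" "\<And>t. \<bar>g' t\<bar> \<le> real K * g t"
    using assms(2) by (rule slowly_varyingE) blast
  show ?thesis
  proof (rule slowly_varyingI)
    show "real_trig (N + K) (\<lambda>t. f t * g t)"
      using assms(1,2) by (auto simp: slowly_varying_def intro: real_trig_mult)
    show "((\<lambda>t. f t * g t) has_real_derivative f' t * g t + g' t * f t) (at t)" for t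
      by (rule DERIV_mult[OF f'(1) g'(1)])
    show "\<bar>f' t * g t + g' t * f t\<bar> \<le> real (N + K) * (f t * g t)" for t
    proof -
      have "\<bar>f' t * g t + g' t * f t\<bar> \<le> \<bar>f' t\<bar> * g t + \<bar>g' t\<bar> * f t"
        using assms(3,4) by (intro order_trans[OF abs_triangle_ineq]) (simp add: abs_mult)
      also have "\<dots> \<le> (real N * f t) * g t + (real K * g t) * f t"
        using assms(3,4) f'(2) g'(2) by (intro add_mono mult_right_mono) auto
      finally show ?thesis by (simp add: algebra_simps)
    qed
  qed
qed

section \<open>Iterated polynomial steps\<close>

text \<open>The cubic with fixed points \<open>0\<close>, \<open>1/2\<close>, \<open>1\<close> and critical points \<open>0\<close> and \<open>1\<close>. The outer fixed
  points are superattracting, so that iteration produces polynomial approximations to the jump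
  at \<open>1/2\<close> whose error away from it is doubly exponentially small, while the degree only grows
  exponentially.\<close>

definition smoothstep :: "real \<Rightarrow> real" where
  "smoothstep y = 3 * y ^ 2 - 2 * y ^ 3"

text \<open>The degree triples. The logarithmic derivative at most doubles, because
  \<open>y s'(y) / s(y) = 6 (1 - y) / (3 - 2 y) \<le> 2\<close> for the step polynomial \<open>s\<close>.\<close>

lemma slowly_varying_smoothstep:
  assumes f: "slowly_varying N f" and bounds: "\<And>t. 0 \<le> f t" "\<And>t. f t \<le> 1"
  shows "slowly_varying (3 * N) (\<lambda>t. smoothstep (f t))"
proof -
  obtain f' where f': "\<And>t. (f has_real_derivative f' t) (at t)" "\<And>t. \<bar>f' t\<bar> \<le> real N * f t"
    using f by (rule slowly_varyingE) blast
  have trig: "real_trig N f" using f by (simp add: slowly_varying_def)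
  show ?thesis
  proof (rule slowly_varyingI)
    have sq: "real_trig (N + N) (\<lambda>t. f t * f t)"
      by (rule real_trig_mult[OF trig trig])
    have "real_trig (3 * N) (\<lambda>t. 3 * (f t * f t) + (- 2) * (f t * f t * f t))"
    proof (rule real_trig_add)
      show "real_trig (3 * N) (\<lambda>t. 3 * (f t * f t))"
        using real_trig_mono[OF real_trig_cmult[OF sq]] by simp
      show "real_trig (3 * N) (\<lambda>t. (- 2) * (f t * f t * f t))"
        using real_trig_mono[OF real_trig_cmult[OF real_trig_mult[OF sq trig]], of "3 * N" "- 2"]
        by simp
    qed
    then show "real_trig (3 * N) (\<lambda>t. smoothstep (f t))"
      by (simp add: smoothstep_def power2_eq_square power3_eq_cube)
    show "((\<lambda>t. smoothstep (f t)) has_real_derivative 6 * f t * (1 - f t) * f' t) (at t)" for t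
      unfolding smoothstep_def
      by (rule derivative_eq_intros f'(1) refl)+ (simp add: algebra_simps power2_eq_square)
    show "\<bar>6 * f t * (1 - f t) * f' t\<bar> \<le> real (3 * N) * smoothstep (f t)" for t
    proof -
      have "\<bar>6 * f t * (1 - f t) * f' t\<bar> = 6 * f t * (1 - f t) * \<bar>f' t\<bar>"
        using bounds by (simp add: abs_mult)
      also have "\<dots> \<le> 6 * f t * (1 - f t) * (real N * f t)"
        using bounds f'(2) by (intro mult_left_mono) auto
      also have "\<dots> = real N * (f t ^ 2 * (6 - 6 * f t))"
        by (simp add: power2_eq_square algebra_simps)
      also have "\<dots> \<le> real N * (f t ^ 2 * (9 - 6 * f t))"
        by (intro mult_left_mono) auto
      also have "\<dots> = real (3 * N) * smoothstep (f t)"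
        by (simp add: smoothstep_def power2_eq_square power3_eq_cube algebra_simps)
      finally show ?thesis .
    qed
  qed
qed

lemma smoothstep_range: "0 \<le> y \<Longrightarrow> y \<le> 1 \<Longrightarrow> 0 \<le> smoothstep y \<and> smoothstep y \<le> 1"
proof -
  assume y: "0 \<le> y" "y \<le> 1"
  have "smoothstep y = y ^ 2 * (3 - 2 * y)" "1 - smoothstep y = (1 - y) ^ 2 * (1 + 2 * y)"
    by (simp_all add: smoothstep_def power2_eq_square power3_eq_cube algebra_simps)
  moreover have "0 \<le> y ^ 2 * (3 - 2 * y)" "0 \<le> (1 - y) ^ 2 * (1 + 2 * y)"
    using y by auto
  ultimately show ?thesis by linarith
qed

lemma smoothstep_mono:
  assumes "0 \<le> x" "x \<le> y" "y \<le> 1"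
  shows "smoothstep x \<le> smoothstep y"
proof (rule DERIV_nonneg_imp_nondecreasing[OF assms(2)])
  fix z assume "x \<le> z" "z \<le> y"
  then have "0 \<le> 6 * z * (1 - z)" using assms by simp
  moreover have "(smoothstep has_real_derivative 6 * z * (1 - z)) (at z)"
    unfolding smoothstep_def[abs_def]
    by (auto intro!: derivative_eq_intros simp: algebra_simps power2_eq_square)
  ultimately show "\<exists>D. (smoothstep has_real_derivative D) (at z) \<and> 0 \<le> D" by blast
qed

abbreviation steps :: "nat \<Rightarrow> real \<Rightarrow> real" where
  "steps i \<equiv> smoothstep ^^ i"

lemma steps_range: "0 \<le> y \<Longrightarrow> y \<le> 1 \<Longrightarrow> 0 \<le> steps i y \<and> steps i y \<le> 1"
  by (induction i) (auto intro: smoothstep_range[THEN conjunct1] smoothstep_range[THEN conjunct2])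

lemma steps_mono: "0 \<le> x \<Longrightarrow> x \<le> y \<Longrightarrow> y \<le> 1 \<Longrightarrow> steps i x \<le> steps i y"
  by (induction i) (use steps_range in \<open>auto intro!: smoothstep_mono\<close>)

lemma smoothstep_reflect: "smoothstep (1 - y) = 1 - smoothstep y"
  by (simp add: smoothstep_def power2_eq_square power3_eq_cube algebra_simps)

lemma steps_reflect: "steps i (1 - y) = 1 - steps i y"
  by (induction i) (auto simp: smoothstep_reflect)

lemma steps_half: "steps i (1 / 2) = 1 / 2"
  using steps_reflect[of i "1 / 2"] by simp

lemma steps_lower:
  assumes "0 \<le> y" "y \<le> 1"
  shows "y ^ (2 ^ i) \<le> steps i y"
proof (induction i)
  case (Suc i)
  define x where "x = steps i y"
  have x: "0 \<le> x" "x \<le> 1" using steps_range[OF assms] by (auto simp: x_def)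
  have "y ^ (2 ^ Suc i) = (y ^ (2 ^ i)) ^ 2" by (simp add: power_mult[symmetric] mult.commute)
  also have "\<dots> \<le> x ^ 2" using Suc assms by (intro power_mono) (auto simp: x_def)
  also have "\<dots> \<le> x ^ 2 * (3 - 2 * x)" using x mult_left_mono[of 1 "3 - 2 * x" "x ^ 2"] by simp
  also have "\<dots> = steps (Suc i) y"
    by (simp add: x_def smoothstep_def power2_eq_square power3_eq_cube algebra_simps)
  finally show ?case .
qed simp

text \<open>While it is larger than \<open>1/4\<close>, the iterate recedes from the repelling fixed point \<open>1/2\<close>: its
  distance \<open>z \<le> 1/4\<close> to it is multiplied by \<open>3/2 - 2 z\<^sup>2 \<ge> 11/8\<close>.\<close>

lemma steps_escape:
  assumes y: "0 \<le> y" "y \<le> 1 / 2 - d / 4" and d: "0 < d" and j: "1 \<le> d * (11 / 8) ^ j"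
  shows "steps j y \<le> 1 / 4"
proof -
  have "steps i y \<le> max (1 / 4) (1 / 2 - d * (11 / 8) ^ i / 4)" for i
  proof (induction i)
    case (Suc i)
    define x where "x = steps i y"
    define z where "z = d * (11 / 8) ^ i / 4"
    have z: "0 < z" using d by (simp add: z_def)
    have x: "0 \<le> x" "x \<le> 1" using steps_range[of y i] y d by (auto simp: x_def)
    show ?case
    proof (cases "x \<le> 1 / 4")
      case True
      have "smoothstep x \<le> smoothstep (1 / 4)" using x True by (intro smoothstep_mono) auto
      also have "\<dots> \<le> 1 / 4" by (simp add: smoothstep_def power2_eq_square power3_eq_cube)
      finally show ?thesis by (simp add: x_def)
    next
      case False
      then have le: "x \<le> 1 / 2 - z" using Suc by (simp add: x_def z_def)
      then have z4: "z \<le> 1 / 4" using False by simp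
      have "smoothstep x \<le> smoothstep (1 / 2 - z)"
        using x z le by (intro smoothstep_mono) auto
      also have "\<dots> = 1 / 2 - z * (3 / 2 - 2 * z ^ 2)"
        by (simp add: smoothstep_def power2_eq_square power3_eq_cube algebra_simps)
      also have "\<dots> \<le> 1 / 2 - z * (11 / 8)"
      proof -
        have "z ^ 2 \<le> (1 / 4) ^ 2" using z z4 by (intro power_mono) auto
        then have "11 / 8 \<le> 3 / 2 - 2 * z ^ 2" by (simp add: power2_eq_square)
        then show ?thesis using z by (intro diff_left_mono mult_left_mono) auto
      qed
      finally show ?thesis by (simp add: x_def z_def)
    qed
  qed (use y in auto)
  from this[of j] j show ?thesis by auto
qed

text \<open>Near \<open>0\<close> the step is dominated by \<open>3 y\<^sup>2\<close>, so \<open>3 y\<close> is at least squared each time.\<close>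

lemma steps_collapse:
  assumes "0 \<le> y" "y \<le> 1 / 4"
  shows "3 * steps l y \<le> (3 / 4) ^ (2 ^ l)"
proof (induction l)
  case (Suc l)
  define x where "x = steps l y"
  have x: "0 \<le> x" using steps_range[of y l] assms by (auto simp: x_def)
  have "3 * smoothstep x \<le> (3 * x) ^ 2"
    using x by (simp add: smoothstep_def power2_eq_square power3_eq_cube)
  also have "\<dots> \<le> ((3 / 4) ^ (2 ^ l)) ^ 2"
    using Suc x by (intro power_mono) (auto simp: x_def)
  finally show ?case by (simp add: x_def power_mult[symmetric] mult.commute)
qed (use assms in auto)

lemma steps_small:
  assumes y: "0 \<le> y" "y \<le> 1 / 2 - d / 4" and d: "0 < d" and j: "1 \<le> d * (11 / 8) ^ j"
  shows "steps (l + j) y \<le> (3 / 4) ^ (2 ^ l)"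
proof -
  have "0 \<le> steps j y" using steps_range[of y j] y d by auto
  from steps_collapse[OF this steps_escape[OF assms], of l] steps_range[of y "l + j"] y d
  show ?thesis by (simp add: funpow_add)
qed

section \<open>The factors of the weight\<close>

lemma sin_ge_half:
  fixes x :: real
  assumes "0 \<le> x" "x \<le> 1"
  shows "x / 2 \<le> sin x"
proof -
  have "sin 0 - 0 / 2 \<le> sin x - x / 2"
  proof (rule DERIV_nonneg_imp_nondecreasing[OF assms(1)])
    fix z :: real assume z: "0 \<le> z" "z \<le> x"
    have "cos (pi / 3) \<le> cos z"
      using z assms pi_gt3 by (intro cos_monotone_0_pi_le) auto
    then have "0 \<le> cos z - 1 / 2" by (simp add: cos_60)
    moreover have "((\<lambda>x. sin x - x / 2) has_real_derivative cos z - 1 / 2) (at z)"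
      by (auto intro!: derivative_eq_intros)
    ultimately show "\<exists>D. ((\<lambda>x. sin x - x / 2) has_real_derivative D) (at z) \<and> 0 \<le> D" by blast
  qed
  then show ?thesis by simp
qed

lemma one_minus_cos_ge:
  fixes x :: real
  assumes "0 \<le> x" "x \<le> 1"
  shows "x ^ 2 / 4 \<le> 1 - cos x"
proof -
  have "1 - cos 0 - 0 ^ 2 / 4 \<le> 1 - cos x - x ^ 2 / 4"
  proof (rule DERIV_nonneg_imp_nondecreasing[OF assms(1)])
    fix z :: real assume z: "0 \<le> z" "z \<le> x"
    have "0 \<le> sin z - z / 2" using sin_ge_half[of z] z assms by simp
    moreover have "((\<lambda>x. 1 - cos x - x ^ 2 / 4) has_real_derivative sin z - z / 2) (at z)"
      by (auto intro!: derivative_eq_intros)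
    ultimately show "\<exists>D. ((\<lambda>x. 1 - cos x - x ^ 2 / 4) has_real_derivative D) (at z) \<and> 0 \<le> D"
      by blast
  qed
  then show ?thesis by simp
qed

lemma one_minus_cos_convex:
  fixes x :: real
  assumes x: "0 \<le> x" "x \<le> 1" and r: "0 \<le> r" "r \<le> 1"
  shows "1 - cos (r * x) \<le> r * (1 - cos x)"
proof -
  have "r * (1 - cos 0) - (1 - cos (r * 0)) \<le> r * (1 - cos x) - (1 - cos (r * x))"
  proof (rule DERIV_nonneg_imp_nondecreasing[OF x(1)])
    fix z :: real assume z: "0 \<le> z" "z \<le> x"
    have "r * z \<le> 1 * z" using r z by (intro mult_right_mono) auto
    then have "sin (r * z) \<le> sin z"
      using z x r pi_gt3 by (intro sin_monotone_2pi_le) (auto intro: order_trans[of _ 0])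
    then have "0 \<le> r * (sin z - sin (r * z))" using r by simp
    moreover have "((\<lambda>x. r * (1 - cos x) - (1 - cos (r * x))) has_real_derivative
        r * (sin z - sin (r * z))) (at z)"
      by (auto intro!: derivative_eq_intros simp: algebra_simps)
    ultimately show "\<exists>D. ((\<lambda>x. r * (1 - cos x) - (1 - cos (r * x))) has_real_derivative D) (at z) \<and> 0 \<le> D"
      by blast
  qed
  then show ?thesis by simp
qed

text \<open>The step of stage \<open>n\<close> is iterated \<open>16 (expo n)\<close> times: \<open>7 (expo n)\<close> iterations to get from
  distance about \<open>9 ^ (- expo n)\<close> below the fixed point \<open>1/2\<close> down to \<open>1/4\<close>, twice \<open>expo n\<close> to
  compensate constants, and \<open>7 (expo n)\<close> for the doubly exponential collapse. The offset \<open>2\<close> makes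
  the first stage long enough to absorb the absolute constants.\<close>

definition expo :: "nat \<Rightarrow> nat" where
  "expo n = 16 ^ (n + 2)"

text \<open>The radius of the \<open>n\<close>-th jump. It is a small multiple of the reciprocal of the bandwidth of the
  first \<open>n\<close> factors, so that neither their product \<open>W\<close> nor \<open>T W\<close>, for \<open>T\<close> of that degree, can
  change much over this distance. The constant \<open>256\<close> beats the Bernstein constant of \<open>T W\<close>.\<close>

definition width :: "nat \<Rightarrow> real" where
  "width n = 1 / (256 * 3 ^ expo n)"

definition level :: "nat \<Rightarrow> real \<Rightarrow> real" where
  "level n t = 1 / 2 + (cos (width n) - cos t) / 4"

text \<open>A trigonometric polynomial that jumps at \<open>\<bar>t\<bar> = width n\<close> from nearly \<open>0\<close> to nearly \<open>1\<close>.\<close>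

definition factor :: "nat \<Rightarrow> real \<Rightarrow> real" where
  "factor n t = steps (expo (Suc n)) (level n t)"

definition partial_weight :: "nat \<Rightarrow> real \<Rightarrow> real" where
  "partial_weight n t = (\<Prod>j<n. factor j t)"

definition weight :: "real \<Rightarrow> real" where
  "weight t = lim (\<lambda>n. partial_weight n t)"

lemma expo_Suc: "expo (Suc n) = 16 * expo n"
  by (simp add: expo_def)

lemma expo_ge: "256 \<le> expo n" "n + 256 \<le> expo n"
proof -
  have "n + 1 \<le> (16::nat) ^ n"
    by (induction n) auto
  then show "n + 256 \<le> expo n" by (simp add: expo_def)
  then show "256 \<le> expo n" by simp
qed

lemma expo_mono: "m \<le> n \<Longrightarrow> expo m \<le> expo n"
  by (simp add: expo_def)

lemma strict_mono_expo: "strict_mono expo"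
  by (simp add: strict_mono_Suc_iff expo_Suc expo_def)

lemma width_pos: "0 < width n" and width_le: "width n \<le> 1 / 256"
  by (simp_all add: width_def field_simps)

lemma width_antimono: "m \<le> n \<Longrightarrow> width n \<le> width m"
  unfolding width_def by (intro divide_left_mono mult_left_mono power_increasing expo_mono) auto

lemma width_Suc: "2 * width (Suc n) \<le> width n"
proof -
  have "2 * (3::real) ^ expo n \<le> 3 ^ 1 * 3 ^ expo n" by simp
  also have "\<dots> = 3 ^ (1 + expo n)" by (simp add: power_add)
  also have "\<dots> \<le> 3 ^ expo (Suc n)"
    using expo_ge(1)[of n] by (intro power_increasing) (auto simp: expo_Suc)
  finally show ?thesis by (simp add: width_def field_simps)
qed

lemma width_tendsto_0: "width \<longlonglongrightarrow> 0"
proof (rule real_tendsto_sandwich[OF _ _ tendsto_const])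
  show "\<forall>\<^sub>F n in sequentially. width n \<le> (1 / 3) ^ n"
  proof (intro always_eventually allI)
    fix n
    have "(3::real) ^ n \<le> 3 ^ expo n"
      using expo_ge(2)[of n] by (intro power_increasing) auto
    also have "\<dots> \<le> 256 * 3 ^ expo n" by simp
    finally show "width n \<le> (1 / 3) ^ n" by (simp add: width_def field_simps)
  qed
  show "\<forall>\<^sub>F n in sequentially. 0 \<le> width n"
    using width_pos by (intro always_eventually allI less_imp_le)
qed (auto intro: LIMSEQ_realpow_zero)

lemma cos_width: "0 \<le> cos (width n)"
  using width_le[of n] width_pos[of n] pi_gt3 by (intro cos_ge_zero) auto

lemma level_range: "1 / 4 \<le> level n t" "level n t \<le> 1"
proof -
  note bounds = cos_width[of n] cos_le_one[of "width n"] cos_le_one[of t] cos_ge_minus_one[of t]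
  from bounds show "1 / 4 \<le> level n t" unfolding level_def diff_divide_distrib by linarith
  from bounds show "level n t \<le> 1" unfolding level_def diff_divide_distrib by linarith
qed

lemma factor_lower: "(1 / 4) ^ (2 ^ expo (Suc n)) \<le> factor n t"
proof -
  have "(1 / 4) ^ (2 ^ expo (Suc n)) \<le> level n t ^ (2 ^ expo (Suc n))"
    using level_range by (intro power_mono) auto
  also have "\<dots> \<le> factor n t"
    unfolding factor_def using level_range[of n t] by (intro steps_lower) auto
  finally show ?thesis .
qed

lemma factor_pos: "0 < factor n t"
  by (rule less_le_trans[OF _ factor_lower]) simp

lemma factor_le_1: "factor n t \<le> 1"
  using steps_range[of "level n t"] level_range[of n t] by (simp add: factor_def)

lemma factor_antimono_cos: "cos t \<le> cos s \<Longrightarrow> factor n s \<le> factor n t"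
  unfolding factor_def using level_range[of n]
  by (intro steps_mono) (auto simp: level_def intro: order_trans[of 0 "1/4"])

lemma factor_at_width: "factor n (width n) = 1 / 2"
  using steps_half by (simp add: factor_def level_def)

text \<open>The symmetry \<open>s(1 - y) = 1 - s(y)\<close> of the step turns smallness at the origin into closeness
  to \<open>1\<close> away from it: \<open>2 cos\<^sup>2 b - 1 \<le> 2 cos b - 1\<close> for \<open>b = width n\<close> says that the level at
  \<open>t\<close> lies at least as far above \<open>1/2\<close> as the level at \<open>0\<close> lies below.\<close>

lemma factor_far:
  assumes "cos t \<le> cos (2 * width n)"
  shows "1 - factor n 0 \<le> factor n t"
proof -
  have "cos (width n) * cos (width n) \<le> cos (width n) * 1"
    using cos_width by (intro mult_left_mono) auto
  moreover have "cos (2 * width n) = 2 * (cos (width n) * cos (width n)) - 1"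
    by (simp add: cos_double_cos power2_eq_square)
  ultimately have "1 - level n 0 \<le> level n t"
    using assms unfolding level_def cos_zero diff_divide_distrib by linarith
  then have "steps (expo (Suc n)) (1 - level n 0) \<le> factor n t"
    unfolding factor_def using level_range[of n] by (intro steps_mono) auto
  then show ?thesis by (simp add: steps_reflect factor_def)
qed

text \<open>By convexity of \<open>1 - cos\<close> the level at \<open>r (width n)\<close> falls below \<open>1/2\<close> by at least
  \<open>(1 - r)/4\<close> times a quantity of order \<open>9 ^ (- expo n)\<close>. To bring it down to \<open>1/4\<close>, \<open>7 (expo n)\<close> iterations gain a
  factor \<open>9 ^ expo n\<close>, \<open>expo n\<close> iterations absorb the constants, and another \<open>expo n\<close>
  the factor \<open>1 - r\<close>.\<close>

lemma factor_inside:
  assumes r: "0 \<le> r" "r < 1" and n: "1 \<le> (1 - r) * (11 / 8) ^ expo n"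
  shows "factor n (r * width n) \<le> (3 / 4) ^ (2 ^ (7 * expo n))"
proof -
  define e b where "e = expo n" and "b = width n"
  have b: "0 < b" "b \<le> 1" using width_pos[of n] width_le[of n] by (auto simp: b_def)
  define d where "d = (1 - r) * (b ^ 2 / 4)"
  have "level n (r * b) \<le> 1 / 2 - d / 4"
  proof -
    have "d \<le> (1 - r) * (1 - cos b)"
      unfolding d_def using r one_minus_cos_ge[of b] b by (intro mult_left_mono) auto
    moreover have "1 - cos (r * b) \<le> r * (1 - cos b)"
      using r b by (intro one_minus_cos_convex) auto
    ultimately have "d \<le> cos (r * b) - cos b" by (simp add: algebra_simps)
    then show ?thesis unfolding level_def b_def diff_divide_distrib by linarith
  qed
  moreover have "1 \<le> d * (11 / 8) ^ (9 * e)"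
  proof -
    have "(9::real) ^ e \<le> ((11 / 8) ^ 7) ^ e"
      by (intro power_mono) (auto simp: power_divide)
    \<comment> \<open>The constant is \<open>4 \<cdot> 256\<^sup>2\<close>, from \<open>b\<^sup>2 / 4\<close>; \<open>54 = 3 \<cdot> 18\<close> is below the first exponent \<open>256\<close>.\<close>
    moreover have "(2::real) ^ 18 \<le> (11 / 8) ^ e"
    proof -
      have "(2::real) ^ 18 \<le> ((11 / 8) ^ 3) ^ 18"
        by (intro power_mono) (auto simp: power_divide)
      also have "\<dots> = (11 / 8) ^ 54" by (simp flip: power_mult)
      also have "\<dots> \<le> (11 / 8) ^ e"
        using expo_ge(1)[of n] by (intro power_increasing) (auto simp: e_def)
      finally show ?thesis .
    qed
    ultimately have "9 ^ e * 2 ^ 18 \<le> ((11 / 8) ^ 7) ^ e * (11 / 8 :: real) ^ e"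
      by (intro mult_mono) auto
    also have "\<dots> = (11 / 8) ^ (8 * e)" by (simp flip: power_mult power_add)
    finally have "1 \<le> (11 / 8) ^ (8 * e) / ((9::real) ^ e * 2 ^ 18)"
      by (subst pos_le_divide_eq) auto
    moreover have "b ^ 2 / 4 = 1 / ((9::real) ^ e * 2 ^ 18)"
    proof -
      have "(9::real) ^ e = 3 ^ e * 3 ^ e" by (simp flip: power_mult_distrib)
      then show ?thesis by (simp add: b_def width_def e_def power2_eq_square)
    qed
    ultimately have "1 \<le> b ^ 2 / 4 * (11 / 8) ^ (8 * e)" by simp
    with n have "1 * 1 \<le> (b ^ 2 / 4 * (11 / 8) ^ (8 * e)) * ((1 - r) * (11 / 8) ^ e)"
      by (intro mult_mono) (auto simp: e_def)
    also have "\<dots> = d * ((11 / 8) ^ (8 * e) * (11 / 8) ^ e)" by (simp add: d_def)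
    also have "\<dots> = d * (11 / 8) ^ (9 * e)" by (simp flip: power_add)
    finally show ?thesis by simp
  qed
  moreover have "0 < d" "0 \<le> level n (r * b)"
    using r b level_range[of n "r * b"] by (auto simp: d_def)
  ultimately have "steps (7 * e + 9 * e) (level n (r * b)) \<le> (3 / 4) ^ (2 ^ (7 * e))"
    by (intro steps_small) auto
  then show ?thesis by (simp add: factor_def expo_Suc e_def b_def)
qed

lemma factor_zero: "factor n 0 \<le> (3 / 4) ^ (2 ^ (7 * expo n))"
  using factor_inside[of 0 n] by simp

lemma factor_zero_geometric: "factor n 0 \<le> (1 / 2) ^ (n + 2)"
proof -
  have "3 * (n + 2) \<le> 7 * expo n" using expo_ge(2)[of n] by simp
  also have "\<dots> \<le> 2 ^ (7 * expo n)" by (rule less_imp_le[OF less_exp])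
  finally have "(3 / 4 :: real) ^ (2 ^ (7 * expo n)) \<le> (3 / 4) ^ (3 * (n + 2))"
    by (intro power_decreasing) auto
  also have "\<dots> = ((3 / 4) ^ 3) ^ (n + 2)" by (simp only: power_mult)
  also have "\<dots> \<le> (1 / 2) ^ (n + 2)" by (intro power_mono) (auto simp: power_divide)
  finally show ?thesis using factor_zero[of n] by linarith
qed

lemma slowly_varying_level: "slowly_varying 1 (level n)"
proof (rule slowly_varyingI)
  have "real_trig 1 (\<lambda>t. (1 / 2 + cos (width n) / 4) + (- 1 / 4) * cos t)"
    by (intro real_trig_add real_trig_const real_trig_cmult) (simp add: real_trig_def trig_poly_cos[simplified])
  then show "real_trig 1 (level n)"
    by (simp add: level_def[abs_def] algebra_simps diff_divide_distrib)
  show "(level n has_real_derivative sin t / 4) (at t)" for t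
    unfolding level_def[abs_def] by (auto intro!: derivative_eq_intros)
  show "\<bar>sin t / 4\<bar> \<le> real 1 * level n t" for t
  proof -
    have "\<bar>sin t / 4\<bar> = \<bar>sin t\<bar> / 4" by simp
    then show ?thesis using level_range(1)[of n t] abs_sin_le_one[of t] by linarith
  qed
qed

lemma slowly_varying_factor: "slowly_varying (3 ^ expo (Suc n)) (factor n)"
proof -
  have "slowly_varying (3 ^ i) (\<lambda>t. steps i (level n t))" for i
  proof (induction i)
    case 0
    then show ?case using slowly_varying_level[of n] by (simp add: eta_contract_eq)
  next
    case (Suc i)
    have "0 \<le> level n t" for t using level_range[of n t] by simp
    then show ?case
      using slowly_varying_smoothstep[OF Suc] steps_range level_range by simp
  qed
  then show ?thesis by (simp add: factor_def[abs_def])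
qed

section \<open>The infinite product\<close>

text \<open>A bound for both the degree and the logarithmic derivative of the product of the first
  \<open>n\<close> factors. These numbers are the degrees \<open>K\<^sub>n\<close> for which the weighted Bernstein inequality is
  proved.\<close>

abbreviation bandwidth :: "nat \<Rightarrow> nat" where
  "bandwidth n \<equiv> 2 * 3 ^ expo n"

lemma partial_weight_Suc: "partial_weight (Suc n) t = partial_weight n t * factor n t"
  by (simp add: partial_weight_def)

lemma partial_weight_pos: "0 < partial_weight n t"
  unfolding partial_weight_def by (intro prod_pos) (simp add: factor_pos)

lemma partial_weight_le_1: "partial_weight n t \<le> 1"
  unfolding partial_weight_def by (intro prod_le_1) (simp add: factor_pos factor_le_1 less_imp_le)

lemma partial_weight_antimono_cos:
  "cos t \<le> cos s \<Longrightarrow> partial_weight n s \<le> partial_weight n t"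
  unfolding partial_weight_def
  by (intro prod_mono) (simp add: factor_pos less_imp_le factor_antimono_cos)

lemma decseq_partial_weight: "decseq (\<lambda>n. partial_weight n t)"
  unfolding decseq_Suc_iff partial_weight_Suc
  using partial_weight_pos factor_le_1 by (simp add: mult_left_le less_imp_le)

lemma slowly_varying_partial_weight: "slowly_varying (bandwidth n) (partial_weight n)"
proof (induction n)
  case 0
  then show ?case
    using slowly_varying_one[of "bandwidth 0"] by (simp add: partial_weight_def[abs_def])
next
  case (Suc n)
  have "slowly_varying (bandwidth n + 3 ^ expo (Suc n)) (\<lambda>t. partial_weight n t * factor n t)"
    using partial_weight_pos factor_pos
    by (intro slowly_varying_mult Suc slowly_varying_factor) (auto intro: less_imp_le)
  moreover have "bandwidth n + 3 ^ expo (Suc n) \<le> bandwidth (Suc n)"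
  proof -
    have "2 * 3 ^ expo n \<le> (3::nat) ^ 1 * 3 ^ expo n" by simp
    also have "\<dots> = 3 ^ (1 + expo n)" by (simp add: power_add)
    also have "\<dots> \<le> 3 ^ expo (Suc n)"
      using expo_ge(1)[of n] by (intro power_increasing) (auto simp: expo_Suc)
    finally show ?thesis by simp
  qed
  moreover have "0 \<le> partial_weight n t * factor n t" for t
    using partial_weight_pos[of n t] factor_pos[of n t] by simp
  moreover have "partial_weight (Suc n) = (\<lambda>t. partial_weight n t * factor n t)"
    by (rule ext) (rule partial_weight_Suc)
  ultimately show ?case
    by (metis slowly_varying_mono)
qed

lemma partial_weight_tendsto: "(\<lambda>n. partial_weight n t) \<longlonglongrightarrow> weight t"
proof -
  obtain L where "(\<lambda>n. partial_weight n t) \<longlonglongrightarrow> L"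
    using decseq_convergent[OF decseq_partial_weight, of 0] partial_weight_pos less_imp_le by metis
  then show ?thesis by (simp add: weight_def limI)
qed

lemma weight_le_partial: "weight t \<le> partial_weight n t"
  using decseq_ge[OF decseq_partial_weight partial_weight_tendsto] .

lemma weight_nonneg: "0 \<le> weight t"
  by (rule LIMSEQ_le_const[OF partial_weight_tendsto]) (auto intro: less_imp_le partial_weight_pos)

lemma weight_le_1: "weight t \<le> 1"
  using weight_le_partial partial_weight_le_1 order_trans by blast

lemma weight_antimono_cos: "cos t \<le> cos s \<Longrightarrow> weight s \<le> weight t"
  by (rule LIMSEQ_le[OF partial_weight_tendsto partial_weight_tendsto])
    (auto intro: partial_weight_antimono_cos)

lemma weight_eq_if_cos_eq: "cos s = cos t \<Longrightarrow> weight s = weight t"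
  by (intro antisym weight_antimono_cos) auto

text \<open>The remaining factors differ from \<open>1\<close> there by at most their values at the origin, whose
  sum is at most \<open>1/2\<close>.\<close>

lemma weight_far:
  assumes t: "cos t \<le> cos (2 * width n)"
  shows "partial_weight n t \<le> 2 * weight t"
proof -
  have "partial_weight n t / 2 \<le> partial_weight m t" if "n \<le> m" for m
  proof -
    have "factor j 0 \<in> {0..1}" for j
      using factor_pos[of j 0] factor_le_1[of j 0] by simp
    then have "1 - (\<Sum>j=n..<m. factor j 0) \<le> (\<Prod>j=n..<m. 1 - factor j 0)"
      by (intro Weierstrass_prod_ineq)
    also have "\<dots> \<le> (\<Prod>j=n..<m. factor j t)"
    proof (intro prod_mono conjI)
      fix j assume j: "j \<in> {n..<m}"
      have "cos (2 * width n) \<le> cos (2 * width j)"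
        using j width_antimono[of n j] width_pos[of j] width_le[of n] pi_gt3
        by (intro cos_monotone_0_pi_le) auto
      then show "1 - factor j 0 \<le> factor j t" using t by (intro factor_far) auto
    qed (use factor_le_1 in auto)
    finally have "1 - (\<Sum>j=n..<m. factor j 0) \<le> (\<Prod>j=n..<m. factor j t)" .
    moreover have "(\<Sum>j=n..<m. factor j 0) \<le> (\<Sum>j<m. (1 / 2) ^ (j + 2))"
    proof (rule order_trans[OF sum_mono])
      show "factor j 0 \<le> (1 / 2) ^ (j + 2)" for j by (rule factor_zero_geometric)
    qed (intro sum_mono2, auto)
    moreover have "(\<Sum>j<m. (1 / 2 :: real) ^ (j + 2)) \<le> 1 / 2"
    proof -
      have "(\<Sum>j<m. (1 / 2 :: real) ^ (j + 2)) = 1 / 2 - (1 / 2) ^ (m + 1)"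
        by (induction m) (auto simp: field_simps)
      then show ?thesis by simp
    qed
    ultimately have "1 / 2 \<le> (\<Prod>j=n..<m. factor j t)" by linarith
    then have "partial_weight n t * (1 / 2) \<le> partial_weight n t * (\<Prod>j=n..<m. factor j t)"
      using partial_weight_pos by (intro mult_left_mono) (auto intro: less_imp_le)
    also have "\<dots> = partial_weight m t"
      unfolding partial_weight_def lessThan_atLeast0 using that by (simp add: prod.atLeastLessThan_concat)
    finally show ?thesis by simp
  qed
  then have "partial_weight n t / 2 \<le> weight t"
    by (intro LIMSEQ_le_const[OF partial_weight_tendsto]) blast
  then show ?thesis by simp
qed

lemma partial_weight_zero_Suc:
  "partial_weight (Suc n) 0 \<le> (3 / 4) ^ (2 ^ (7 * expo n))"
proof -
  have "partial_weight (Suc n) 0 \<le> 1 * factor n 0"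
    unfolding partial_weight_Suc using partial_weight_le_1 factor_pos
    by (intro mult_right_mono) (auto intro: less_imp_le)
  then show ?thesis using factor_zero[of n] by simp
qed

lemma weight_zero: "weight 0 = 0"
proof -
  have "weight 0 \<le> (1 / 2) ^ n" for n
  proof -
    have "weight 0 \<le> partial_weight n 0 * factor n 0"
      using weight_le_partial[of 0 "Suc n"] by (simp add: partial_weight_Suc)
    also have "\<dots> \<le> 1 * (1 / 2) ^ (n + 2)"
      using partial_weight_le_1 partial_weight_pos factor_pos factor_zero_geometric
      by (intro mult_mono) (auto intro: less_imp_le)
    also have "\<dots> \<le> (1 / 2) ^ n" by simp
    finally show ?thesis .
  qed
  moreover have "(\<lambda>n. (1 / 2 :: real) ^ n) \<longlonglongrightarrow> 0" by (intro LIMSEQ_realpow_zero) auto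
  ultimately have "weight 0 \<le> 0" by (intro LIMSEQ_le_const) auto
  then show ?thesis using weight_nonneg[of 0] by simp
qed

lemma cos_le_cos_2_width:
  assumes "2 * width n \<le> \<bar>t\<bar>" "\<bar>t\<bar> \<le> pi"
  shows "cos t \<le> cos (2 * width n)"
  using cos_monotone_0_pi_le[of "2 * width n" "\<bar>t\<bar>"] width_pos[of n] assms by simp

lemma weight_pos:
  assumes "t \<noteq> 0" "\<bar>t\<bar> \<le> pi"
  shows "0 < weight t"
proof -
  have "\<forall>\<^sub>F n in sequentially. width n < \<bar>t\<bar> / 2"
    using width_tendsto_0 assms(1) by (intro order_tendstoD) auto
  then obtain n where "width n < \<bar>t\<bar> / 2" by (auto simp: eventually_sequentially)
  then have "partial_weight n t \<le> 2 * weight t"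
    using assms by (intro weight_far cos_le_cos_2_width) auto
  then show ?thesis using partial_weight_pos[of n t] by linarith
qed

text \<open>The logarithmic derivative times the distance \<open>2 (width n)\<close> is at most \<open>1/64\<close>.\<close>

lemma partial_weight_doubling: "partial_weight n (2 * width n) \<le> 2 * partial_weight n 0"
proof -
  define b where "b = 2 * width n"
  have b: "0 < b" "b \<le> 1" using width_pos[of n] width_le[of n] by (auto simp: b_def)
  obtain W' where W': "\<And>t. (partial_weight n has_real_derivative W' t) (at t)"
    "\<And>t. \<bar>W' t\<bar> \<le> real (bandwidth n) * partial_weight n t"
    using slowly_varying_partial_weight by (rule slowly_varyingE) blast
  obtain z where z: "0 < z" "z < b" "partial_weight n b - partial_weight n 0 = (b - 0) * W' z"
    using MVT2[OF b(1) W'(1)] by blast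
  have "b * W' z \<le> b * (real (bandwidth n) * partial_weight n b)"
  proof (rule mult_left_mono)
    have "cos b \<le> cos z" using z b pi_gt3 by (intro cos_monotone_0_pi_le) auto
    then have "partial_weight n z \<le> partial_weight n b" by (rule partial_weight_antimono_cos)
    then have "real (bandwidth n) * partial_weight n z \<le> real (bandwidth n) * partial_weight n b"
      by (intro mult_left_mono) auto
    with W'(2)[of z] show "W' z \<le> real (bandwidth n) * partial_weight n b" by linarith
  qed (use b in auto)
  also have "\<dots> = partial_weight n b / 64" by (simp add: b_def width_def)
  finally show ?thesis
    using z(3) partial_weight_pos[of n b] by (simp add: b_def)
qed

text \<open>Where \<open>factor n\<close> is far from \<open>1\<close>, the product of the earlier factors is already about as small
  as at the origin.\<close>

lemma partial_weight_increment:
  "\<bar>partial_weight (Suc n) t - partial_weight n t\<bar> \<le> 2 * partial_weight n 0 + factor n 0"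
proof -
  have eq: "\<bar>partial_weight (Suc n) t - partial_weight n t\<bar> = partial_weight n t * (1 - factor n t)"
  proof -
    have "partial_weight (Suc n) t - partial_weight n t = - (partial_weight n t * (1 - factor n t))"
      by (simp add: partial_weight_Suc algebra_simps)
    then show ?thesis
      using partial_weight_pos[of n t] factor_le_1[of n t] by (simp add: abs_mult)
  qed
  show ?thesis
  proof (cases "cos t \<le> cos (2 * width n)")
    case True
    have "partial_weight n t * (1 - factor n t) \<le> 1 * factor n 0"
      using factor_far[OF True] partial_weight_le_1 factor_le_1 factor_pos[of n 0]
      by (intro mult_mono) auto
    then show ?thesis using eq partial_weight_pos[of n 0] by linarith
  next
    case False
    then have "partial_weight n t \<le> partial_weight n (2 * width n)"
      by (intro partial_weight_antimono_cos) simp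
    then have "partial_weight n t \<le> 2 * partial_weight n 0"
      using partial_weight_doubling[of n] by linarith
    moreover have "partial_weight n t * (1 - factor n t) \<le> partial_weight n t * 1"
      using partial_weight_pos[of n t] factor_pos[of n t] by (intro mult_left_mono) auto
    ultimately show ?thesis using eq factor_pos[of n 0] by linarith
  qed
qed

section \<open>Smoothness of the weight\<close>

text \<open>The left-hand side is the sup-norm bound of an increment of the partial products times a
  power of its degree, in terms of \<open>x = expo n\<close>.\<close>

lemma eventually_doubly_exponential_le:
  "\<forall>\<^sub>F x in sequentially. 3 * (3 / 4) ^ (2 ^ x) * (2 * 3 ^ (256 * x)) ^ k \<le> (1 / 2 :: real) ^ x"
proof -
  have "((\<lambda>x::real. 3 * (3 / 4) powr (2 powr x) * (2 * 3 powr (256 * x)) powr real k * 2 powr x) \<longlongrightarrow> 0) at_top"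
    by real_asymp
  then have "\<forall>\<^sub>F x in at_top. 3 * (3 / 4) powr (2 powr x) * (2 * 3 powr (256 * x)) powr real k * 2 powr x < (1::real)"
    by (rule order_tendstoD) simp
  then have "\<forall>\<^sub>F n in sequentially. 3 * (3 / 4) powr (2 powr real n) * (2 * 3 powr (256 * real n)) powr real k * 2 powr real n < (1::real)"
    by (rule eventually_compose_filterlim[OF _ filterlim_real_sequentially])
  then show ?thesis
  proof eventually_elim
    case (elim n)
    have "(3 / 4) powr (2 powr real n) = (3 / 4 :: real) ^ (2 ^ n)"
      by (simp add: powr_realpow[symmetric])
    moreover have "(2 * 3 powr (256 * real n)) powr real k = (2 * 3 ^ (256 * n) :: real) ^ k"
    proof -
      have "3 powr (256 * real n) = (3 :: real) ^ (256 * n)"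
        using powr_realpow[of 3 "256 * n"] by simp
      then show ?thesis by (simp add: powr_realpow)
    qed
    moreover have "2 powr real n = (2 :: real) ^ n" by (simp add: powr_realpow)
    ultimately have "3 * (3 / 4) ^ (2 ^ n) * (2 * 3 ^ (256 * n)) ^ k * 2 ^ n < (1::real)"
      using elim by simp
    then show ?case by (simp add: power_one_over pos_le_divide_eq)
  qed
qed

text \<open>The increment of index \<open>n + 1\<close> has degree exponential in \<open>expo n\<close>, but its size is doubly
  exponentially small, since so is the value of \<open>factor n\<close> at the origin.\<close>

lemma smooth_weight: "smooth weight"
proof -
  define f where "f n t = partial_weight (Suc n) t - partial_weight n t" for n t
  define \<rho> where "\<rho> n = 2 * partial_weight n 0 + factor n 0" for n
  have "smooth (\<lambda>t. 1 + (\<Sum>n. f n t))"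
  proof (rule smooth_series)
    show "real_trig (bandwidth (Suc n)) (f n)" for n
    proof -
      have "bandwidth n \<le> bandwidth (Suc n)"
        using expo_mono[of n "Suc n"] by (simp add: power_increasing)
      moreover have "real_trig (bandwidth m) (partial_weight m)" for m
        using slowly_varying_partial_weight[of m] by (simp add: slowly_varying_def)
      ultimately have "real_trig (bandwidth (Suc n)) (\<lambda>t. partial_weight (Suc n) t + (- 1) * partial_weight n t)"
        by (intro real_trig_add real_trig_cmult) (blast intro: real_trig_mono)+
      then show ?thesis by (simp add: f_def[abs_def])
    qed
    show "\<bar>f n t\<bar> \<le> \<rho> n" for n t
      unfolding f_def \<rho>_def by (rule partial_weight_increment)
    show "summable (\<lambda>n. \<rho> n * real (bandwidth (Suc n)) ^ k)" for k
    proof (subst summable_Suc_iff[symmetric], rule summable_comparison_test_ev)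
      have "filterlim expo at_top sequentially"
        by (rule filterlim_subseq[OF strict_mono_expo])
      from eventually_compose_filterlim[OF eventually_doubly_exponential_le[of k] this]
      show "\<forall>\<^sub>F n in sequentially. norm (\<rho> (Suc n) * real (bandwidth (Suc (Suc n))) ^ k) \<le> (1 / 2) ^ n"
      proof (eventually_elim)
        case (elim n)
        have "(3 / 4 :: real) ^ 2 ^ (7 * expo m) \<le> (3 / 4) ^ 2 ^ expo n" if "n \<le> m" for m
          using expo_mono[OF that] by (intro power_decreasing power_increasing) auto
        then have "\<rho> (Suc n) \<le> 3 * (3 / 4) ^ 2 ^ expo n"
          using partial_weight_zero_Suc[of n] factor_zero[of "Suc n"]
          unfolding \<rho>_def by (smt (verit) le_Suc_eq order_refl)
        moreover have "0 \<le> \<rho> (Suc n)"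
          using partial_weight_pos[of "Suc n" 0] factor_pos[of "Suc n" 0] by (simp add: \<rho>_def)
        moreover have "real (bandwidth (Suc (Suc n))) = 2 * 3 ^ (256 * expo n)"
          by (simp add: expo_Suc)
        ultimately have "norm (\<rho> (Suc n) * real (bandwidth (Suc (Suc n))) ^ k)
            \<le> 3 * (3 / 4) ^ 2 ^ expo n * (2 * 3 ^ (256 * expo n)) ^ k"
          by (simp add: mult_right_mono)
        also have "\<dots> \<le> (1 / 2) ^ expo n" by (rule elim)
        also have "\<dots> \<le> (1 / 2 :: real) ^ n"
          using expo_ge(2)[of n] by (intro power_decreasing) auto
        finally show ?case .
      qed
    qed (simp add: summable_geometric)
  qed
  moreover have "1 + (\<Sum>n. f n t) = weight t" for t
    using telescope_sums[OF partial_weight_tendsto[of t]]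
    by (simp add: f_def sums_iff partial_weight_def)
  ultimately show ?thesis by (simp add: eta_contract_eq)
qed

section \<open>Jumps of the logarithm of the weight\<close>

lemma partial_weight_zero_lower: "(1 / 4) ^ (2 * 2 ^ expo n) \<le> partial_weight n 0"
proof (induction n)
  case 0
  then show ?case by (simp add: partial_weight_def power_le_one)
next
  case (Suc n)
  have "2 * 2 ^ expo n \<le> (2::nat) ^ expo (Suc n)"
    using expo_ge(1)[of n] by (simp flip: power_Suc add: expo_Suc power_increasing)
  then have "(1 / 4 :: real) ^ (2 * 2 ^ expo (Suc n))
      \<le> (1 / 4) ^ (2 * 2 ^ expo n + 2 ^ expo (Suc n))"
    by (intro power_decreasing) auto
  also have "\<dots> \<le> partial_weight n 0 * factor n 0"
    unfolding power_add using Suc factor_lower partial_weight_pos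
    by (intro mult_mono) (auto intro: less_imp_le)
  finally show ?case by (simp add: partial_weight_Suc)
qed

text \<open>For the lower bound: at the jump, \<open>factor n\<close> equals \<open>1/2\<close>, the later factors contribute at least another \<open>1/2\<close>,
  and the earlier ones are at least as large as at the origin.\<close>

lemma weight_at_width:
  "(1 / 4) ^ (3 * 2 ^ expo n) \<le> weight (width n)" "weight (width n) \<le> 1 / 2"
proof -
  have "partial_weight (Suc n) (width n) \<le> 2 * weight (width n)"
    using width_Suc[of n] width_pos[of n] width_le[of n] pi_gt3
    by (intro weight_far cos_le_cos_2_width) auto
  moreover have "partial_weight n 0 / 2 \<le> partial_weight (Suc n) (width n)"
    using partial_weight_antimono_cos[of "width n" 0 n] by (simp add: partial_weight_Suc factor_at_width)
  ultimately have "(1 / 4) ^ (2 * 2 ^ expo n) * (1 / 4) \<le> weight (width n)"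
    using partial_weight_zero_lower[of n] by linarith
  moreover have "(1 / 4 :: real) ^ (3 * 2 ^ expo n) \<le> (1 / 4) ^ (2 * 2 ^ expo n + 1)"
    by (intro power_decreasing) auto
  ultimately show "(1 / 4) ^ (3 * 2 ^ expo n) \<le> weight (width n)" by simp
  have "partial_weight (Suc n) (width n) \<le> 1 * (1 / 2)"
    unfolding partial_weight_Suc factor_at_width using partial_weight_le_1 by (intro mult_right_mono) auto
  then show "weight (width n) \<le> 1 / 2" using weight_le_partial[of "width n" "Suc n"] by linarith
qed

text \<open>Up to constants, \<open>- ln\<close> of the weight is at most \<open>2 ^ expo n\<close> at the jump, and at least
  \<open>2 ^ (7 (expo n))\<close> at a fixed fraction of its radius.\<close>

lemma ln_weight_ratio:
  assumes r: "0 < r" "r < 1" and n: "1 \<le> (1 - r) * (11 / 8) ^ expo n"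
  shows "real n \<le> ln (weight (r * width n)) / ln (weight (width n))"
proof -
  define e where "e = expo n"
  have b: "0 < width n" "width n \<le> 1" using width_pos[of n] width_le[of n] by auto
  have rb: "0 < r * width n" "r * width n \<le> 1"
    using r b mult_mono[of r 1 "width n" 1] by auto
  have pos: "0 < weight (width n)" "0 < weight (r * width n)"
    using b rb pi_gt3 by (intro weight_pos; auto)+
  have "ln ((1 / 4 :: real) ^ (3 * 2 ^ e)) \<le> ln (weight (width n))"
    using weight_at_width(1)[of n] by (intro ln_mono) (auto simp: e_def)
  then have "- ln (weight (width n)) \<le> 3 * 2 ^ e * ln 4"
    by (simp add: ln_realpow ln_div)
  also have "\<dots> \<le> 3 * 2 ^ e * 2"
  proof (intro mult_left_mono)
    show "ln 4 \<le> (2::real)" using ln_2_less_1 ln_realpow[of "2::real" 2] by simp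
  qed auto
  finally have outer: "- ln (weight (width n)) \<le> 6 * 2 ^ e" by simp
  have "ln (weight (width n)) \<le> ln (1 / 2)"
    using weight_at_width(2)[of n] pos by (intro ln_mono) auto
  also have "ln (1 / 2) = - ln (2::real)" by (simp add: ln_div)
  finally have neg: "0 < - ln (weight (width n))"
    using ln_gt_zero[of "2::real"] by linarith
  have "weight (r * width n) \<le> partial_weight n (r * width n) * factor n (r * width n)"
    using weight_le_partial[of _ "Suc n"] by (simp add: partial_weight_Suc)
  also have "\<dots> \<le> 1 * factor n (r * width n)"
    using partial_weight_le_1 factor_pos by (intro mult_right_mono) (auto intro: less_imp_le)
  also have "\<dots> \<le> (3 / 4) ^ (2 ^ (7 * e))"
    using factor_inside[of r n] r n by (simp add: e_def)
  finally have "ln (weight (r * width n)) \<le> ln ((3 / 4) ^ (2 ^ (7 * e)))"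
    using pos by (intro ln_mono) auto
  also have "\<dots> = 2 ^ (7 * e) * ln (3 / 4)" by (simp add: ln_realpow)
  also have "\<dots> \<le> 2 ^ (7 * e) * (- 1 / 4)"
    using ln_le_minus_one[of "3 / 4 :: real"] by (intro mult_left_mono) auto
  finally have inner: "2 ^ (7 * e) / 4 \<le> - ln (weight (r * width n))" by simp
  have "n \<le> 2 ^ e" using expo_ge(2)[of n] less_exp[of e] unfolding e_def by linarith
  then have "real n \<le> real (2 ^ e)" by (rule of_nat_mono)
  then have "real n * (6 * 2 ^ e) \<le> 2 ^ e * (6 * 2 ^ e)"
    by (intro mult_right_mono) auto
  also have "\<dots> \<le> 2 ^ (7 * e) / 4"
  proof -
    have "(24::real) \<le> 2 ^ 5" by simp
    also have "\<dots> \<le> 2 ^ (5 * e)" using expo_ge(1)[of n] by (intro power_increasing) (auto simp: e_def)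
    finally have "24 * 2 ^ (2 * e) \<le> (2::real) ^ (5 * e) * 2 ^ (2 * e)" by (intro mult_right_mono) auto
    also have "\<dots> = 2 ^ (7 * e)" by (simp flip: power_add)
    finally show ?thesis by (simp add: power_mult power2_eq_square mult_2 power_add)
  qed
  finally have "real n * (- ln (weight (width n))) \<le> - ln (weight (r * width n))"
    using inner mult_left_mono[OF outer, of "real n"] by linarith
  then have "real n \<le> (- ln (weight (r * width n))) / (- ln (weight (width n)))"
    using neg by (simp only: pos_le_divide_eq)
  then show ?thesis by simp
qed

lemma Limsup_ln_weight_ratio:
  assumes r: "0 < r" "r < 1"
  shows "Limsup (at 0) (\<lambda>t. ereal (ln (weight (r * t)) / ln (weight t))) = \<infinity>"
proof -
  have "\<forall>\<^sub>F n in sequentially. 1 \<le> (1 - r) * (11 / 8) ^ expo n"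
  proof -
    have "filterlim (\<lambda>n. (11 / 8 :: real) ^ n) at_top sequentially"
      by real_asymp
    then have "\<forall>\<^sub>F n in sequentially. 1 / (1 - r) \<le> (11 / 8) ^ n"
      by (simp add: filterlim_at_top)
    from eventually_compose_filterlim[OF this filterlim_subseq[OF strict_mono_expo]]
    show ?thesis using r by (simp add: field_simps)
  qed
  then have large: "\<forall>\<^sub>F n in sequentially. real n \<le> ln (weight (r * width n)) / ln (weight (width n))"
    by eventually_elim (rule ln_weight_ratio[OF r])
  have width: "filterlim width (at 0) sequentially"
    using width_tendsto_0 width_pos by (simp add: filterlim_at less_imp_neq[symmetric])
  have "(SUP t\<in>Collect P. ereal (ln (weight (r * t)) / ln (weight t))) = \<infinity>"
    if P: "eventually P (at 0)" for P
  proof (rule ereal_top)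
    fix B :: real
    have "\<forall>\<^sub>F n in sequentially. B \<le> real n"
      using filterlim_real_sequentially by (simp add: filterlim_at_top)
    with large eventually_compose_filterlim[OF P width]
    have "\<forall>\<^sub>F n in sequentially. P (width n) \<and> B \<le> ln (weight (r * width n)) / ln (weight (width n))"
      by eventually_elim auto
    then obtain n where "P (width n)" "B \<le> ln (weight (r * width n)) / ln (weight (width n))"
      by (auto simp: eventually_sequentially)
    then show "ereal B \<le> (SUP t\<in>Collect P. ereal (ln (weight (r * t)) / ln (weight t)))"
      by (intro SUP_upper2[of "width n"]) auto
  qed
  then have "\<infinity> \<le> Limsup (at 0) (\<lambda>t. ereal (ln (weight (r * t)) / ln (weight t)))"
    unfolding Limsup_def by (intro INF_greatest) simp
  then show ?thesis by simp
qed

section \<open>The weighted Bernstein inequality\<close>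

lemma norm_le_sup_norm:
  assumes "\<And>t. norm (f t) \<le> B"
  shows "norm (f t) \<le> sup_norm f"
  unfolding sup_norm_def using assms by (intro cSUP_upper bdd_aboveI2[of _ _ B]) auto

lemma sup_norm_le:
  assumes "\<And>t. norm (f t) \<le> B"
  shows "sup_norm f \<le> B"
  unfolding sup_norm_def using assms by (intro cSUP_least) auto

lemma dist_le_vector_derivative_bound:
  fixes f :: "real \<Rightarrow> 'a::real_normed_vector"
  assumes "\<And>t. (f has_vector_derivative f' t) (at t)" "\<And>t. norm (f' t) \<le> B"
  shows "norm (f s - f t) \<le> B * \<bar>s - t\<bar>"
proof -
  have "norm (f s - f t) \<le> B * norm (s - t)"
  proof (rule differentiable_bound[of UNIV f "\<lambda>t h. h *\<^sub>R f' t"])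
    show "(f has_derivative (\<lambda>h. h *\<^sub>R f' x)) (at x within UNIV)" for x
      using assms(1)[of x] by (simp add: has_vector_derivative_def)
    show "onorm (\<lambda>h. h *\<^sub>R f' x) \<le> B" for x
    proof (rule onorm_le)
      show "norm (h *\<^sub>R f' x) \<le> B * norm h" for h
        using mult_right_mono[OF assms(2)[of x], of "\<bar>h\<bar>"] by (simp add: mult.commute)
    qed
  qed auto
  then show ?thesis by simp
qed

text \<open>Modulo \<open>2\<pi>\<close>, a point with \<open>\<bar>t\<bar> < 2 (width n)\<close> is close to the point \<open>2 (width n)\<close>, where
  the weight and its partial product are comparable.\<close>

lemma near_or_far:
  obtains "cos t \<le> cos (2 * width n)"
  | s where "\<bar>t - s\<bar> \<le> 4 * width n" "cos s = cos (2 * width n)"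
proof (cases "cos t \<le> cos (2 * width n)")
  case False
  define k where "k = round (t / (2 * pi))"
  define u where "u = t - 2 * pi * of_int k"
  have ct: "cos u = cos t"
    using cos_int_2pin[of k] sin_int_2pin[of k] by (simp add: u_def cos_diff)
  have "\<bar>of_int k - t / (2 * pi)\<bar> \<le> 1 / 2"
    unfolding k_def by (rule of_int_round_abs_le)
  then have "\<bar>of_int k - t / (2 * pi)\<bar> * (2 * pi) \<le> 1 / 2 * (2 * pi)"
    by (intro mult_right_mono) auto
  also have "\<bar>of_int k - t / (2 * pi)\<bar> * (2 * pi) = \<bar>(of_int k - t / (2 * pi)) * (2 * pi)\<bar>"
    by (simp add: abs_mult)
  also have "(of_int k - t / (2 * pi)) * (2 * pi) = - u" by (simp add: u_def field_simps)
  finally have "\<bar>u\<bar> \<le> pi" by simp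
  then have "\<bar>u\<bar> < 2 * width n"
    using cos_le_cos_2_width[of n u] False ct by linarith
  then have "\<bar>t - (2 * width n + 2 * pi * of_int k)\<bar> \<le> 4 * width n"
    by (simp add: u_def)
  moreover have "cos (2 * width n + 2 * pi * of_int k) = cos (2 * width n)"
    using cos_int_2pin[of k] sin_int_2pin[of k] by (simp add: cos_add)
  ultimately show thesis by (rule that(2))
qed

text \<open>Let \<open>W\<close> be the product of the first \<open>n\<close> factors and \<open>N\<close> its bandwidth. Both the derivative of
  the trigonometric polynomial \<open>T W\<close> and \<open>T W'\<close> are of order \<open>N\<close> times the norm of \<open>T W\<close>, hence so
  is \<open>T' W\<close>, which dominates \<open>T'\<close> times the weight. It remains to see that the norm of \<open>T W\<close> is
  at most four times that of \<open>T\<close> times the weight: outside the \<open>n\<close>-th jump \<open>W\<close> is at most twice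
  the weight, and the gap around the origin is so short that, by Bernstein's inequality,
  \<open>T W\<close> changes across it by less than half of its norm.\<close>

lemma weighted_bernstein:
  assumes T: "T \<in> trig_polys (bandwidth n)"
  shows "sup_norm (\<lambda>t. weight t *\<^sub>R vector_derivative T (at t))
    \<le> 60 * real (bandwidth n) * sup_norm (\<lambda>t. weight t *\<^sub>R T t)"
proof -
  define N where "N = bandwidth n"
  define W where "W = partial_weight n"
  define G where "G t = W t *\<^sub>R T t" for t
  define M where "M = sup_norm G"
  define S where "S = sup_norm (\<lambda>t. weight t *\<^sub>R T t)"
  have W: "0 < W t" "W t \<le> 1" "weight t \<le> W t" for t
    by (simp_all add: W_def partial_weight_pos partial_weight_le_1 weight_le_partial)
  have trig: "trig_poly N T" using trig_poly_of_trig_polys T by (simp add: N_def)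
  obtain T' where T': "\<And>t. (T has_vector_derivative T' t) (at t)"
    by (rule trig_poly_bernstein[OF trig]) (rule that)
  obtain W' where W': "\<And>t. (W has_real_derivative W' t) (at t)" "\<And>t. \<bar>W' t\<bar> \<le> real N * W t"
    unfolding W_def N_def using slowly_varying_partial_weight by (rule slowly_varyingE) blast
  obtain B where B: "\<And>t. norm (T t) \<le> B"
    by (rule trig_poly_bounded[OF trig]) (rule that)
  have B0: "0 \<le> B" using order_trans[OF norm_ge_zero B] .
  have "norm (G t) \<le> B" for t
    using W[of t] B[of t] mult_mono[of "W t" 1 "norm (T t)" B] by (simp add: G_def)
  then have GM: "norm (G t) \<le> M" for t unfolding M_def by (rule norm_le_sup_norm)
  have "norm (weight t *\<^sub>R T t) \<le> B" for t
    using weight_nonneg[of t] weight_le_1[of t] B[of t] mult_mono[of "weight t" 1 "norm (T t)" B]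
    by simp
  then have TS: "weight t * norm (T t) \<le> S" for t
    unfolding S_def using norm_le_sup_norm[of "\<lambda>t. weight t *\<^sub>R T t" B t] weight_nonneg[of t] by simp
  have "trig_poly (N + N) (\<lambda>t. of_real (W t) * T t)"
    using slowly_varying_partial_weight[of n] trig
    by (intro trig_poly_mult) (auto simp: slowly_varying_def real_trig_def W_def N_def)
  then have "trig_poly (N + N) G" by (simp add: G_def[abs_def] scaleR_conv_of_real)
  then obtain G' where G': "\<And>t. (G has_vector_derivative G' t) (at t)"
    "\<And>M t. (\<And>s. norm (G s) \<le> M) \<Longrightarrow> norm (G' t) \<le> 7 * real (N + N) * M"
    using trig_poly_bernstein by metis
  have G'_le: "norm (G' t) \<le> 14 * real N * M" for t
    using G'(2)[OF GM, of t] by simp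
  have far: "norm (G t) \<le> 2 * S" if "cos t \<le> cos (2 * width n)" for t
  proof -
    have "norm (G t) = W t * norm (T t)" using W[of t] by (simp add: G_def)
    also have "\<dots> \<le> 2 * weight t * norm (T t)"
      using weight_far[OF that] by (intro mult_right_mono) (auto simp: W_def)
    finally show ?thesis using TS[of t] by simp
  qed
  have "0 \<le> M" using order_trans[OF norm_ge_zero GM] .
  have "0 \<le> S" using TS[of 0] by (simp add: weight_zero)
  have "norm (G t) \<le> 2 * S + M / 2" for t
  proof (cases rule: near_or_far[of t n])
    case 1
    then show ?thesis using far \<open>0 \<le> M\<close> by fastforce
  next
    case (2 s)
    have "norm (G t - G s) \<le> 14 * real N * M * \<bar>t - s\<bar>"
      by (rule dist_le_vector_derivative_bound[OF G'(1) G'_le])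
    also have "\<dots> \<le> 14 * real N * M * (4 * width n)"
      using 2 \<open>0 \<le> M\<close> by (intro mult_left_mono) auto
    \<comment> \<open>\<open>7/16 = 14 \<cdot> 2 \<cdot> 4 / 256\<close>, and only a value below \<open>1\<close> matters.\<close>
    also have "\<dots> = 7 / 16 * M" by (simp add: N_def width_def)
    finally have "norm (G t - G s) \<le> M / 2" using \<open>0 \<le> M\<close> by simp
    moreover have "norm (G s) \<le> 2 * S" using far[of s] 2 by simp
    ultimately show ?thesis using norm_triangle_sub[of "G t" "G s"] by linarith
  qed
  then have "M \<le> 2 * S + M / 2" unfolding M_def[symmetric] by (metis M_def sup_norm_le)
  then have MS: "M \<le> 4 * S" by simp
  show ?thesis
  proof (rule sup_norm_le)
    fix t
    have "(G has_vector_derivative W t *\<^sub>R T' t + W' t *\<^sub>R T t) (at t)"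
      unfolding G_def[abs_def] by (intro has_vector_derivative_scaleR W'(1) T')
    then have "W t *\<^sub>R T' t = G' t - W' t *\<^sub>R T t"
      using vector_derivative_unique_at[OF G'(1)] by (simp add: algebra_simps)
    then have "norm (W t *\<^sub>R T' t) \<le> norm (G' t) + \<bar>W' t\<bar> * norm (T t)"
      using norm_triangle_ineq4[of "G' t" "W' t *\<^sub>R T t"] by simp
    also have "\<bar>W' t\<bar> * norm (T t) \<le> real N * W t * norm (T t)"
      using W'(2) by (intro mult_right_mono) auto
    also have "\<dots> = real N * norm (G t)" using W[of t] by (simp add: G_def)
    also have "\<dots> \<le> real N * M" using GM by (intro mult_left_mono) auto
    finally have "norm (W t *\<^sub>R T' t) \<le> 15 * real N * M" using G'_le[of t] by simp
    also have "\<dots> \<le> 15 * real N * (4 * S)" using MS by (intro mult_left_mono) auto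
    finally have "W t * norm (T' t) \<le> 60 * real N * S" using W[of t] by simp
    moreover have "weight t * norm (T' t) \<le> W t * norm (T' t)"
      using W by (intro mult_right_mono) auto
    ultimately show "norm (weight t *\<^sub>R vector_derivative T (at t))
        \<le> 60 * real (bandwidth n) * sup_norm (\<lambda>t. weight t *\<^sub>R T t)"
      using weight_nonneg[of t] vector_derivative_at[OF T'[of t]] by (simp add: N_def S_def)
  qed
qed

theorem theorem9p3:
  "\<exists>w :: real \<Rightarrow> real.
     weight_function w \<and> smooth w \<and> (\<forall>t. w (- t) = w t) \<and> w 0 = 0 \<and>
     (\<forall>\<^sub>F t in at 0. w t > 0) \<and>
     (\<exists>\<epsilon>>0. mono_on {0<..<\<epsilon>} w \<and> antimono_on {- \<epsilon><..<0} w) \<and>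
     (\<forall>r. 0 < r \<and> r < 1 \<longrightarrow>
        Limsup (at 0) (\<lambda>t. ereal (ln (w (r * t)) / ln (w t))) = \<infinity>) \<and>
     (\<exists>(K :: nat \<Rightarrow> nat) (C :: real). strict_mono K \<and> (\<forall>n. K n > 0) \<and>
        (\<forall>n. \<forall>T \<in> trig_polys (K n).
           sup_norm (\<lambda>t. w t *\<^sub>R vector_derivative T (at t))
             \<le> C * real (K n) * sup_norm (\<lambda>t. w t *\<^sub>R T t)))"
proof (rule exI[of _ weight], intro conjI)
  show "weight_function weight"
    unfolding weight_function_def periodic_2pi_def
  proof (intro conjI allI)
    have "(deriv ^^ 0) weight differentiable_on UNIV"
      using smooth_weight unfolding smooth_def by blast
    then have "continuous_on {- pi..pi} weight"
      by (auto intro: differentiable_imp_continuous_on continuous_on_subset)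
    then show "weight absolutely_integrable_on {- pi..pi}"
      by (rule absolutely_integrable_continuous_real)
  qed (auto intro: weight_nonneg weight_eq_if_cos_eq)
  show "smooth weight" by (rule smooth_weight)
  show "\<forall>t. weight (- t) = weight t" by (auto intro: weight_eq_if_cos_eq)
  show "weight 0 = 0" by (rule weight_zero)
  show "\<forall>\<^sub>F t in at 0. weight t > 0"
    unfolding eventually_at by (intro exI[of _ pi]) (auto intro: weight_pos)
  show "\<exists>\<epsilon>>0. mono_on {0<..<\<epsilon>} weight \<and> antimono_on {- \<epsilon><..<0} weight"
  proof (intro exI[of _ pi] conjI)
    show "mono_on {0<..<pi} weight"
      by (intro monotone_onI weight_antimono_cos cos_monotone_0_pi_le) auto
    show "antimono_on {- pi<..<0} weight"
    proof (intro monotone_onI weight_antimono_cos)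
      fix x y :: real
      assume "x \<in> {- pi<..<0}" "y \<in> {- pi<..<0}" "x \<le> y"
      then show "cos x \<le> cos y" using cos_monotone_0_pi_le[of "- y" "- x"] by simp
    qed
  qed simp
  show "\<forall>r. 0 < r \<and> r < 1 \<longrightarrow>
      Limsup (at 0) (\<lambda>t. ereal (ln (weight (r * t)) / ln (weight t))) = \<infinity>"
    using Limsup_ln_weight_ratio by blast
  have "strict_mono bandwidth"
    using strict_mono_expo by (auto simp: strict_mono_def)
  then show "\<exists>(K :: nat \<Rightarrow> nat) (C :: real). strict_mono K \<and> (\<forall>n. K n > 0) \<and>
      (\<forall>n. \<forall>T \<in> trig_polys (K n).
         sup_norm (\<lambda>t. weight t *\<^sub>R vector_derivative T (at t))
           \<le> C * real (K n) * sup_norm (\<lambda>t. weight t *\<^sub>R T t))"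
    using weighted_bernstein by (intro exI[of _ bandwidth] exI[of _ 60]) auto
qed

end
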